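(* Let $R\ge0$ be such that $\widetilde R\le n$. For any sequence of real numbers $(\lambda_k)_{k=1}^n$ with $\lambda_1\ge\lambda_2\ge\dots\ge\lambda_n$, there exists a subset $\mathfrak H_R\subseteq\mathfrak S_n$ such that for all $u\in\mathcal M_R$, $$\min_{\sigma\in\mathfrak S_n}\Big\{\sum_{k=1}^{\widetilde R}(u_k-\lambda_{\sigma(k)})^2+\sum_{k=\widetilde R+1}^n\lambda_{\sigma(k)}^2\Big\}=\min_{\sigma\in\mathfrak H_R}\Big\{\sum_{k=1}^{\widetilde R}(u_k-\lambda_{\sigma(k)})^2+\sum_{k=\widetilde R+1}^n\lambda_{\sigma(k)}^2\Big\},$$ where the set $\mathfrak H_R$ depends only on $R$ (for fixed $n$ and $\mathbf d$; in particular not on $(\lambda_k)$ nor on $u$) and has size at most $(R+2)!$.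
   Context: Fix an integer $\mathbf d\ge3$. Let $d_0=1$, $d_1=\mathbf d$ and $d_\ell=\binom{\ell+\mathbf d-1}{\ell}-\binom{\ell+\mathbf d-3}{\ell-2}$ for $\ell\ge2$ (dimension of the space of spherical harmonics of degree $\ell$ on the unit sphere of $\mathbb R^{\mathbf d}$), and $\widetilde R:=\sum_{\ell=0}^Rd_\ell$. $\mathfrak S_n$ is the set of permutations of $\{1,\dots,n\}$. $\mathcal M_R\subset\mathbb R^{\widetilde R}$ is the set of vectors of the form $(\underbrace{u_0}_{d_0},\underbrace{u_1,\dots,u_1}_{d_1},\dots,\underbrace{u_R,\dots,u_R}_{d_R})$ with $u_0,\dots,u_R\in\mathbb R$. *)

theory Defs
  imports Complex_Main "HOL-Library.FuncSet" "HOL-Combinatorics.Permutations"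
begin

(* Subtraction is on nat; it never truncates for d \<ge> 3, since
   (l+d-3) choose (l-2) \<le> (l+d-1) choose l. *)
definition harm_dim :: "nat \<Rightarrow> nat \<Rightarrow> nat" where
  "harm_dim d l =
     (if l = 0 then 1 else if l = 1 then d
      else ((l + d - 1) choose l) - ((l + d - 3) choose (l - 2)))"

definition total_harm_dim :: "nat \<Rightarrow> nat \<Rightarrow> nat" where
  "total_harm_dim d R = (\<Sum>l = 0..R. harm_dim d l)"

(* A vector in real N-space is a function on {1..N}, extensional outside {1..N}.
   Block l occupies the indices d_0 + ... + d_(l-1) + 1, ..., d_0 + ... + d_l. *)
definition block_vectors :: "nat \<Rightarrow> nat \<Rightarrow> (nat \<Rightarrow> real) set" where
  "block_vectors d R =
     {u \<in> {1..total_harm_dim d R} \<rightarrow>\<^sub>E UNIV.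
        \<exists>v :: nat \<Rightarrow> real. \<forall>l \<le> R.
          \<forall>k \<in> {(\<Sum>j<l. harm_dim d j) <.. (\<Sum>j\<le>l. harm_dim d j)}. u k = v l}"

definition matching_cost ::
  "nat \<Rightarrow> nat \<Rightarrow> (nat \<Rightarrow> real) \<Rightarrow> (nat \<Rightarrow> real) \<Rightarrow> (nat \<Rightarrow> nat) \<Rightarrow> real" where
  "matching_cost N n u lam \<sigma> =
     (\<Sum>k = 1..N. (u k - lam (\<sigma> k))\<^sup>2) + (\<Sum>k = N + 1..n. (lam (\<sigma> k))\<^sup>2)"

end

(* Padding u with zeros up to length n gives a vector that is constant on R + 2 blocks (the last one
   with value 0), and every cost is the squared distance between it and a permutation of lam.  By the
   rearrangement inequality a permutation is optimal as soon as it orders lam like the padded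
   vector, and whether it does so depends only on the relative order of the R + 2 block values.  So
   one permutation for each of the (R + 2)! orders of the blocks suffices. *)
theory Submission imports Defs begin

text \<open>Sorting with ties broken somehow, by induction on the largest position \<open>m\<close>:
  move a maximiser \<open>a\<close> of \<open>f\<close> to \<open>m\<close>, then sort the remaining
  values. It is used twice below, once to rank the blocks and once to sort the positions by the rank
  of their block.\<close>

lemma ex_permutes_order_preserving:
  fixes A :: "'a::linorder set" and f :: "'a \<Rightarrow> 'b::linorder"
  assumes "finite A"
  shows "\<exists>\<sigma>. \<sigma> permutes A \<and> (\<forall>i\<in>A. \<forall>j\<in>A. f i < f j \<longrightarrow> \<sigma> i < \<sigma> j)"
  using assms
proof (induction A arbitrary: f rule: finite_linorder_max_induct)
  case empty
  then show ?case by (auto intro: permutes_id)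
next
  case (insert m A)
  have "Max (f ` insert m A) \<in> f ` insert m A"
    using insert.hyps by (intro Max_in) auto
  then obtain a where a: "a \<in> insert m A" "f a = Max (f ` insert m A)" by (metis imageE)
  have f_le: "f i \<le> f a" if "i \<in> insert m A" for i
    unfolding a(2) using insert.hyps that by (intro Max_ge) auto
  define t where "t = transpose a m"
  have t: "t permutes insert m A"
    unfolding t_def using a(1) by (intro permutes_swap_id) auto
  \<comment> \<open>After the swap, the values other than \<open>f a\<close> sit on
    \<open>A\<close>, so the induction hypothesis is applied to \<open>f \<circ> t\<close>. Since
    \<open>t\<close> is an involution, its conclusion becomes one about \<open>f\<close> when read
    at \<open>t i\<close> and \<open>t j\<close>.\<close>
  obtain \<tau> where \<tau>: "\<tau> permutes A"
    "\<And>i j. \<lbrakk>i \<in> A; j \<in> A; f (t i) < f (t j)\<rbrakk> \<Longrightarrow> \<tau> i < \<tau> j"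
    using insert.IH[of "f \<circ> t"] by auto
  have \<tau>': "\<tau> permutes insert m A"
    using \<tau>(1) by (rule permutes_subset) auto
  have tt [simp]: "t (t i) = i" for i by (simp add: t_def)
  have t_in: "t i \<in> A" if "i \<in> insert m A" "i \<noteq> a" for i
  proof -
    have "t i \<in> insert m A" using t that(1) by (simp only: permutes_in_image)
    moreover have "t i \<noteq> m" using that(2) by (auto simp: t_def transpose_def split: if_splits)
    ultimately show ?thesis by simp
  qed
  show ?case
  proof (intro exI conjI ballI impI)
    show "\<tau> \<circ> t permutes insert m A" using t \<tau>' by (rule permutes_compose)
  next
    fix i j assume ij: "i \<in> insert m A" "j \<in> insert m A" "f i < f j"
    have "i \<noteq> a" using f_le[OF ij(2)] ij(3) by auto
    then have i: "t i \<in> A" using t_in ij(1) by blast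
    show "(\<tau> \<circ> t) i < (\<tau> \<circ> t) j"
    proof (cases "j = a")
      case True
      \<comment> \<open>The position \<open>a\<close> is sent to \<open>m\<close>, which lies above
        every element of \<open>A\<close>.\<close>
      have "\<tau> m = m" using \<tau>(1) insert.hyps by (auto intro: permutes_not_in)
      moreover have "\<tau> (t i) \<in> A" using \<tau>(1) i by (simp add: permutes_in_image)
      ultimately show ?thesis using True insert.hyps by (simp add: t_def)
    next
      case False
      then show ?thesis using \<tau>(2)[OF i t_in[OF ij(2)]] ij(3) by simp
    qed
  qed
qed

text \<open>Exchange argument: some \<open>a\<close> maximises both \<open>w\<close> and
  \<open>x\<close>. Rerouting \<rho> so that it fixes \<open>a\<close> cannot lower the sum, and the
  rest is the same problem on \<open>A - {a}\<close>.\<close>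

lemma rearrangement_inequality:
  fixes w x :: "'a \<Rightarrow> 'b::linordered_idom"
  assumes "finite A" "\<rho> permutes A"
    and "\<And>i j. \<lbrakk>i \<in> A; j \<in> A; w i < w j\<rbrakk> \<Longrightarrow> x i \<le> x j"
  shows "(\<Sum>k\<in>A. w k * x (\<rho> k)) \<le> (\<Sum>k\<in>A. w k * x k)"
  using assms
proof (induction A arbitrary: \<rho> rule: finite_psubset_induct)
  case (psubset A)
  show ?case
  proof (cases "A = {}")
    case False
    \<comment> \<open>A maximiser of the sum \<open>w + x\<close> maximises both summands:
      \<open>w a < w k\<close> would force \<open>x a \<le> x k\<close> and hence a larger sum at
      \<open>k\<close>. When \<open>w k = w a\<close>, the bound on \<open>x k\<close> comes from
      the sum itself.\<close>
    let ?M = "Max ((\<lambda>k. w k + x k) ` A)"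
    have "?M \<in> (\<lambda>k. w k + x k) ` A"
      using psubset.hyps False by (intro Max_in) auto
    then obtain a where a: "a \<in> A" "w a + x a = ?M" by (metis (no_types, lifting) imageE)
    have sum_le: "w k + x k \<le> w a + x a" if "k \<in> A" for k
      unfolding a(2) using psubset.hyps that by (intro Max_ge) auto
    have w_le: "w k \<le> w a" if "k \<in> A" for k
      using sum_le[OF that] psubset.prems(2)[OF a(1) that] by linarith
    have x_le: "x k \<le> x a" if "k \<in> A" for k
      using sum_le[OF that] w_le[OF that] psubset.prems(2)[OF that a(1)]
      by (cases "w k = w a") auto
    define c where "c = inv \<rho> a"
    have \<rho>c: "\<rho> c = a" unfolding c_def using psubset.prems(1) by (rule permutes_inverses)
    have c: "c \<in> A" using \<rho>c a(1) psubset.prems(1) by (metis permutes_in_image)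
    have \<rho>a: "\<rho> a \<in> A" using a(1) psubset.prems(1) by (simp add: permutes_in_image)
    \<comment> \<open>Swapping the images of \<open>a\<close> and \<open>c\<close> makes
      \<open>a\<close> a fixed point and sends \<open>c\<close> to \<open>\<rho> a\<close>.\<close>
    define \<rho>' where "\<rho>' = \<rho> \<circ> transpose a c"
    have \<rho>'a: "\<rho>' a = a" by (simp add: \<rho>'_def \<rho>c)
    have "\<rho>' permutes A"
      unfolding \<rho>'_def using permutes_swap_id[OF a(1) c] psubset.prems(1)
      by (rule permutes_compose)
    then have \<rho>': "\<rho>' permutes A - {a}"
      by (rule permutes_superset) (use \<rho>'a in auto)
    have IH: "(\<Sum>k\<in>A - {a}. w k * x (\<rho>' k)) \<le> (\<Sum>k\<in>A - {a}. w k * x k)"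
      using a(1) \<rho>' psubset.prems(2) by (intro psubset.IH) auto
    have "(\<Sum>k\<in>A. w k * x (\<rho> k)) \<le> (\<Sum>k\<in>A. w k * x (\<rho>' k))"
    proof (cases "c = a")
      case True
      then show ?thesis by (simp add: \<rho>'_def)
    next
      case False
      have split: "(\<Sum>k\<in>A. g k) = g a + (g c + (\<Sum>k\<in>A - {a} - {c}. g k))" for g :: "'a \<Rightarrow> 'b"
        using psubset.hyps a(1) c False by (simp add: sum.remove[of A a] sum.remove[of "A - {a}" c])
      have rest: "(\<Sum>k\<in>A - {a} - {c}. w k * x (\<rho>' k)) = (\<Sum>k\<in>A - {a} - {c}. w k * x (\<rho> k))"
        by (rule sum.cong) (auto simp: \<rho>'_def transpose_def)
      \<comment> \<open>This product is exactly the gain in the sum when \<rho> is replaced by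
        \<open>\<rho>'\<close>.\<close>
      have "0 \<le> (w a - w c) * (x a - x (\<rho> a))"
        using w_le[OF c] x_le[OF \<rho>a] by simp
      then show ?thesis
        unfolding split rest by (simp add: \<rho>'_def \<rho>c algebra_simps)
    qed
    also have "\<dots> = w a * x a + (\<Sum>k\<in>A - {a}. w k * x (\<rho>' k))"
      using psubset.hyps a(1) by (simp add: sum.remove[of A a] \<rho>'a)
    also have "\<dots> \<le> w a * x a + (\<Sum>k\<in>A - {a}. w k * x k)"
      using IH by simp
    also have "\<dots> = (\<Sum>k\<in>A. w k * x k)"
      using psubset.hyps a(1) by (simp add: sum.remove[of A a])
    finally show ?thesis .
  qed simp
qed

text \<open>Expanding the squares leaves only the cross term dependent on the permutation. The
  rearrangement inequality maximises it, applied to \<open>w\<close> and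
  \<open>lam \<circ> \<sigma>\<close> with the relative permutation
  \<open>inv \<sigma> \<circ> \<tau>\<close>.\<close>

lemma sum_squared_diff_permutes_le:
  fixes w lam :: "'a \<Rightarrow> 'b::linordered_idom"
  assumes "finite A" "\<sigma> permutes A" "\<tau> permutes A"
    and "\<And>i j. \<lbrakk>i \<in> A; j \<in> A; w i < w j\<rbrakk> \<Longrightarrow> lam (\<sigma> i) \<le> lam (\<sigma> j)"
  shows "(\<Sum>k\<in>A. (w k - lam (\<sigma> k))\<^sup>2) \<le> (\<Sum>k\<in>A. (w k - lam (\<tau> k))\<^sup>2)"
proof -
  have expand: "(\<Sum>k\<in>A. (w k - lam (\<pi> k))\<^sup>2) =
      (\<Sum>k\<in>A. (w k)\<^sup>2) + (\<Sum>k\<in>A. (lam k)\<^sup>2) - 2 * (\<Sum>k\<in>A. w k * lam (\<pi> k))"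
    if "\<pi> permutes A" for \<pi>
  proof -
    have "(\<Sum>k\<in>A. (lam k)\<^sup>2) = (\<Sum>k\<in>A. (lam (\<pi> k))\<^sup>2)"
      using sum.permute[OF that, of "\<lambda>k. (lam k)\<^sup>2"] by (simp add: o_def)
    then show ?thesis
      by (simp add: power2_diff sum.distrib sum_subtractf sum_distrib_left mult.assoc)
  qed
  have "inv \<sigma> \<circ> \<tau> permutes A"
    using assms(2,3) by (intro permutes_compose permutes_inv)
  from rearrangement_inequality[OF assms(1) this, of w "lam \<circ> \<sigma>"] assms(4)
  have "(\<Sum>k\<in>A. w k * lam (\<tau> k)) \<le> (\<Sum>k\<in>A. w k * lam (\<sigma> k))"
    using permutes_inverses(1)[OF assms(2)] by simp
  then show ?thesis
    unfolding expand[OF assms(2)] expand[OF assms(3)] by simp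
qed

lemma matching_cost_padded:
  assumes "N \<le> n"
  shows "matching_cost N n u lam \<sigma> = (\<Sum>k = 1..n. ((if k \<le> N then u k else 0) - lam (\<sigma> k))\<^sup>2)"
proof -
  have "(\<Sum>k = 1..n. ((if k \<le> N then u k else 0) - lam (\<sigma> k))\<^sup>2) =
      (\<Sum>k = 1..N. ((if k \<le> N then u k else 0) - lam (\<sigma> k))\<^sup>2) +
      (\<Sum>k = N + 1..n. ((if k \<le> N then u k else 0) - lam (\<sigma> k))\<^sup>2)"
    using assms by (subst sum.union_disjoint[symmetric]) (auto intro!: sum.cong)
  then show ?thesis by (simp add: matching_cost_def)
qed

text \<open>The positions of the zero padding form an extra block numbered \<open>R + 1\<close>. For
  the other positions the bound by \<open>total_harm_dim d R\<close> guarantees that the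
  \<open>LEAST\<close> is attained, by some \<open>l \<le> R\<close>.\<close>

definition block_index :: "nat \<Rightarrow> nat \<Rightarrow> nat \<Rightarrow> nat" where
  "block_index d R k =
     (if k \<le> total_harm_dim d R then LEAST l. k \<le> (\<Sum>j\<le>l. harm_dim d j) else R + 1)"

lemma block_index_le:
  assumes "k \<le> total_harm_dim d R"
  shows "block_index d R k \<le> R"
  using assms unfolding block_index_def total_harm_dim_def
  by (auto intro!: Least_le simp: atLeast0AtMost)

lemma block_index_in_block:
  assumes "1 \<le> k" "k \<le> total_harm_dim d R"
  shows "k \<in> {(\<Sum>j<block_index d R k. harm_dim d j) <.. (\<Sum>j\<le>block_index d R k. harm_dim d j)}"
proof -
  let ?P = "\<lambda>l. k \<le> (\<Sum>j\<le>l. harm_dim d j)"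
  have b: "block_index d R k = (LEAST l. ?P l)"
    using assms(2) by (simp add: block_index_def)
  have "?P R"
    using assms(2) by (simp add: total_harm_dim_def atLeast0AtMost)
  then have "?P (LEAST l. ?P l)" by (rule LeastI)
  moreover have "(\<Sum>j<(LEAST l. ?P l). harm_dim d j) < k"
  proof (cases "LEAST l. ?P l")
    case 0
    then show ?thesis using assms(1) by simp
  next
    case (Suc m)
    \<comment> \<open>Minimality gives the lower end of the block: the partial sum up to
      \<open>m\<close> is still below \<open>k\<close>.\<close>
    then have "\<not> ?P m" by (intro not_less_Least) simp
    then show ?thesis using Suc by (simp add: lessThan_Suc_atMost)
  qed
  ultimately show ?thesis by (simp add: b)
qed

theorem theorem5:
  fixes d R n :: nat
  assumes "3 \<le> d"
    and "total_harm_dim d R \<le> n"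
  shows "\<exists>H. H \<subseteq> {\<sigma>. \<sigma> permutes {1..n}} \<and> H \<noteq> {} \<and> card H \<le> fact (R + 2) \<and>
    (\<forall>lam :: nat \<Rightarrow> real. antimono_on {1..n} lam \<longrightarrow>
      (\<forall>u \<in> block_vectors d R.
        Min (matching_cost (total_harm_dim d R) n u lam ` {\<sigma>. \<sigma> permutes {1..n}})
        = Min (matching_cost (total_harm_dim d R) n u lam ` H)))"
proof -
  let ?N = "total_harm_dim d R" and ?b = "block_index d R"
  let ?S = "{\<sigma>. \<sigma> permutes {1..n}}" and ?P = "{p. p permutes {..R + 1}}"
  have "\<exists>\<sigma>. \<sigma> permutes {1..n} \<and>
      (\<forall>i\<in>{1..n}. \<forall>j\<in>{1..n}. p (?b i) < p (?b j) \<longrightarrow> \<sigma> i < \<sigma> j)" for p :: "nat \<Rightarrow> nat"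
    by (rule ex_permutes_order_preserving) simp
  then obtain s :: "(nat \<Rightarrow> nat) \<Rightarrow> nat \<Rightarrow> nat" where s: "\<And>p. s p permutes {1..n}"
    "\<And>p i j. \<lbrakk>i \<in> {1..n}; j \<in> {1..n}; p (?b i) < p (?b j)\<rbrakk> \<Longrightarrow> s p i < s p j"
    by metis
  have fin: "finite ?P" by (rule finite_permutations) simp
  show ?thesis
  proof (intro exI[of _ "s ` ?P"] conjI allI impI ballI)
    show sub: "s ` ?P \<subseteq> ?S" using s(1) by auto
    show "s ` ?P \<noteq> {}" using permutes_id[of "{..R + 1}"] by blast
    have "card ?P = fact (R + 2)" by (rule card_permutations) auto
    \<comment> \<open>Different rankings may yield the same permutation, hence only an upper
      bound.\<close>
    then show "card (s ` ?P) \<le> fact (R + 2)" using card_image_le[OF fin, of s] by simp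
    fix lam :: "nat \<Rightarrow> real" and u
    assume lam: "antimono_on {1..n} lam" and u: "u \<in> block_vectors d R"
    let ?c = "matching_cost ?N n u lam"
    obtain v where v: "\<And>l k. \<lbrakk>l \<le> R; k \<in> {(\<Sum>j<l. harm_dim d j) <.. (\<Sum>j\<le>l. harm_dim d j)}\<rbrakk>
        \<Longrightarrow> u k = v l"
      using u unfolding block_vectors_def by blast
    define w where "w l = (if l \<le> R then v l else 0)" for l
    have w: "(if k \<le> ?N then u k else 0) = w (?b k)" if "k \<in> {1..n}" for k
    proof (cases "k \<le> ?N")
      case True
      then show ?thesis
        using v[OF block_index_le block_index_in_block] block_index_le that by (simp add: w_def)
    next
      case False
      then show ?thesis by (simp add: w_def block_index_def)
    qed
    have b_le: "?b k \<le> R + 1" for k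
      using block_index_le[of k d R] by (cases "k \<le> ?N") (auto simp: block_index_def)
    \<comment> \<open>The sign reverses the order because \<open>lam\<close> is decreasing: blocks
      with larger values must receive smaller indices. Blocks of equal value are ranked
      arbitrarily.\<close>
    obtain p where p: "p permutes {..R + 1}"
      "\<And>l m. \<lbrakk>l \<le> R + 1; m \<le> R + 1; - w l < - w m\<rbrakk> \<Longrightarrow> p l < p m"
      using ex_permutes_order_preserving[of "{..R + 1}" "\<lambda>l. - w l"] by auto
    have opt: "?c (s p) \<le> ?c \<tau>" if "\<tau> permutes {1..n}" for \<tau>
      unfolding matching_cost_padded[OF assms(2)]
    proof (rule sum_squared_diff_permutes_le)
      fix i j
      assume ij: "i \<in> {1..n}" "j \<in> {1..n}"
        "(if i \<le> ?N then u i else 0) < (if j \<le> ?N then u j else 0)"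
      then have "p (?b j) < p (?b i)"
        unfolding w[OF ij(1)] w[OF ij(2)] by (intro p(2) b_le) simp
      then have "s p j < s p i" using s(2) ij by blast
      moreover have "s p i \<in> {1..n}" "s p j \<in> {1..n}"
        using ij s(1) by (simp_all only: permutes_in_image)
      ultimately show "lam (s p i) \<le> lam (s p j)"
        using lam by (auto simp: monotone_on_def)
    qed (use s(1) that in auto)
    \<comment> \<open>The permutation \<open>s p\<close> beats every competitor and lies in both
      sets, so it attains both minima.\<close>
    have "Min (?c ` ?S) = ?c (s p)"
      using opt s(1) by (intro Min_eqI) (auto intro: finite_imageI finite_permutations)
    moreover have "Min (?c ` s ` ?P) = ?c (s p)"
      using opt s(1) p(1) fin by (intro Min_eqI) auto
    ultimately show "Min (?c ` ?S) = Min (?c ` s ` ?P)" by simp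
  qed
qed

end
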